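(* Let $L$ be a non-nilpotent Leibniz algebra of finite dimension $n+1\ge 3$ over a field $F$. Suppose that $L$ has an ideal $K$ of codimension $1$ which, as a subalgebra, is cyclic and nilpotent. Then there exist an element $d\in L$, a basis $a_1,\dots,a_n$ of $K$, and coefficients $\gamma_2,\gamma_3,\dots,\gamma_n,\delta_n\in F$ such that: (1) $L=K\oplus Fd$ (as vector spaces, $d\ne0$), and $K=Fa_1\oplus\dots\oplus Fa_n$ with $[a_1,a_1]=a_2$, $[a_1,a_{j-1}]=a_j$ for $3\le j\le n$, $[a_1,a_n]=0$, and $[a_m,a_k]=0$ for all $m>1$, $1\le k\le n$; (2) $[a_1,d]=-a_1$ and $[a_j,d]=0$ for all $j\ge2$; (3) for every $1\le k\le n$, $$[d,a_k]=k\,a_k+\sum_{j=2}^{n-k+1}\gamma_j a_{j+k-1};$$ (4) $[d,d]=-(\gamma_3a_2+\gamma_4a_3+\dots+\gamma_na_{n-1})+\delta_na_n$ (the sum in parentheses being empty if $n=2$).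
   Context: A (left) Leibniz algebra over a field $F$ is an $F$-vector space $L$ with a bilinear bracket $[-,-]$ satisfying $[[a,b],c]=[a,[b,c]]-[b,[a,c]]$ for all $a,b,c\in L$. Ideals are two-sided. A Leibniz algebra is cyclic if it is generated as an algebra by one element. The lower central series is $\gamma_1(L)=L$, $\gamma_{k+1}(L)=[L,\gamma_k(L)]$ (the span of all brackets); $L$ is nilpotent if $\gamma_{c+1}(L)=\langle 0\rangle$ for some $c$. *)

theory Defs
  imports Complex_Main
begin

(* The Leibniz algebra is the whole type 'v, so it is written UNIV where a set is needed;
   ideals and subalgebras are subsets.  In vector_space, dim is 0 for infinite-dimensional
   spaces, so a hypothesis dim UNIV = n + 1 includes finite-dimensionality. *)
locale leibniz_algebra = vector_space scale
  for scale :: "'f::field \<Rightarrow> 'v::ab_group_add \<Rightarrow> 'v" +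
  fixes bracket :: "'v \<Rightarrow> 'v \<Rightarrow> 'v"
  assumes linear_bracket_left: "Vector_Spaces.linear scale scale (\<lambda>x. bracket x y)"
    and linear_bracket_right: "Vector_Spaces.linear scale scale (\<lambda>y. bracket x y)"
    and leibniz: "bracket (bracket a b) c = bracket a (bracket b c) - bracket b (bracket a c)"
begin

definition subalgebra :: "'v set \<Rightarrow> bool"
  where "subalgebra S \<longleftrightarrow> subspace S \<and> (\<forall>x\<in>S. \<forall>y\<in>S. bracket x y \<in> S)"

definition ideal :: "'v set \<Rightarrow> bool"
  where "ideal K \<longleftrightarrow> subspace K \<and> (\<forall>x\<in>K. \<forall>y. bracket x y \<in> K \<and> bracket y x \<in> K)"

(* For a subalgebra S: the smallest subalgebra containing g is the same in S as in the
   whole algebra as soon as g lies in S. *)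
definition cyclic :: "'v set \<Rightarrow> bool"
  where "cyclic S \<longleftrightarrow> (\<exists>g\<in>S. S = subalgebra hull {g})"

(* Indexing starts at 0: lower_central S k is the term usually written gamma_(k+1)(S). *)
primrec lower_central :: "'v set \<Rightarrow> nat \<Rightarrow> 'v set"
  where
    "lower_central S 0 = S"
  | "lower_central S (Suc k) = span {bracket x y | x y. x \<in> S \<and> y \<in> lower_central S k}"

definition nilpotent :: "'v set \<Rightarrow> bool"
  where "nilpotent S \<longleftrightarrow> (\<exists>c. lower_central S c = {0})"

end

end

theory Submission
  imports Defs
begin

text \<open>
  Let \<open>g\<close> generate \<open>K\<close>, and write \<open>p\<^sub>0 = g\<close>, \<open>p\<^sub>k\<^sub>+\<^sub>1 = [g, p\<^sub>k]\<close>. Squares annihilate \<open>L\<close> from the left,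
  and the Leibniz identity carries this over to every \<open>p\<^sub>k\<close> with \<open>k \<ge> 1\<close>. Hence the span of the \<open>p\<^sub>k\<close> is
  already closed under the bracket, so it is \<open>K\<close>; and nilpotency makes \<open>p\<^sub>0, \<dots>, p\<^sub>n\<^sub>-\<^sub>1\<close> a basis
  with \<open>p\<^sub>n = 0\<close> (lemma \<open>nilpotent_cyclic_basis\<close>). The basis of the theorem is \<open>a\<^sub>j = p\<^sub>j\<^sub>-\<^sub>1\<close>.

  Take \<open>d\<close> outside \<open>K\<close>. All brackets of \<open>L\<close> lie in \<open>K\<close>. Left multiplication by \<open>d\<close> is a derivation, so it
  is determined on \<open>K\<close> by \<open>[d, g] = \<Sum> c\<^sub>i p\<^sub>i\<close>: it sends \<open>p\<^sub>k\<close> to \<open>(k + 1) c\<^sub>0 p\<^sub>k\<close> plus higher terms with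
  coefficients \<open>c\<^sub>1, c\<^sub>2, \<dots>\<close> (lemma \<open>bracket_left_power_right\<close>). If \<open>c\<^sub>0\<close> were zero, all left multiplications
  would raise the filtration of \<open>K\<close> by the spans of the tails \<open>p\<^sub>k, p\<^sub>k\<^sub>+\<^sub>1, \<dots>\<close>, and \<open>L\<close> would be nilpotent
  (lemma \<open>nilpotent_if_weight_zero\<close>).

  So \<open>c\<^sub>0\<close> is invertible, and \<open>d\<close> may be scaled. The \<open>p\<^sub>0\<close>-coefficient of \<open>[g, d]\<close> is \<open>-c\<^sub>0\<close>,
  because \<open>[g, d] + [d, g]\<close> annihilates \<open>g\<close> from the left; the other terms of \<open>[g, d]\<close> are of the form
  \<open>[g, x]\<close> with \<open>x \<in> K\<close> and disappear when \<open>x\<close> is subtracted from \<open>d\<close>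
  (lemma \<open>exists_normalised_outer_element\<close>). This gives \<open>[g, d] = -g\<close> over any field, since
  only \<open>c\<^sub>0\<close> has been inverted. Finally the Leibniz identity for \<open>[[d, g], d]\<close> expresses \<open>[d, d]\<close> through
  \<open>[d, g]\<close> up to a multiple of \<open>p\<^sub>n\<^sub>-\<^sub>1\<close> (lemma \<open>square_of_normalised_outer_element\<close>).
\<close>

context leibniz_algebra
begin

section \<open>Bilinearity\<close>

lemma bracket_add_left: "bracket (x + y) z = bracket x z + bracket y z"
  using linear_bracket_left[of z] by (simp add: Vector_Spaces.linear_iff)

lemma bracket_add_right: "bracket z (x + y) = bracket z x + bracket z y"
  using linear_bracket_right[of z] by (simp add: Vector_Spaces.linear_iff)

lemma bracket_scale_left: "bracket (scale c x) z = scale c (bracket x z)"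
  using linear_bracket_left[of z] by (simp add: Vector_Spaces.linear_iff)

lemma bracket_scale_right: "bracket z (scale c x) = scale c (bracket z x)"
  using linear_bracket_right[of z] by (simp add: Vector_Spaces.linear_iff)

lemma bracket_zero_left [simp]: "bracket 0 z = 0"
  using bracket_scale_left[of 0 0 z] by simp

lemma bracket_zero_right [simp]: "bracket z 0 = 0"
  using bracket_scale_right[of z 0 0] by simp

lemma bracket_diff_right: "bracket z (x - y) = bracket z x - bracket z y"
  using bracket_add_right[of z "x - y" y] by simp

lemma bracket_diff_left: "bracket (x - y) z = bracket x z - bracket y z"
  using bracket_add_left[of "x - y" y z] by simp

lemma bracket_minus_right: "bracket z (- y) = - bracket z y"
  using bracket_diff_right[of z 0 y] by simp

lemma bracket_minus_left: "bracket (- y) z = - bracket y z"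
  using bracket_diff_left[of 0 y z] by simp

lemma bracket_sum_right: "bracket z (sum f A) = (\<Sum>i\<in>A. bracket z (f i))"
  by (induction A rule: infinite_finite_induct) (auto simp: bracket_add_right)

lemma bracket_sum_left: "bracket (sum f A) z = (\<Sum>i\<in>A. bracket (f i) z)"
  by (induction A rule: infinite_finite_induct) (auto simp: bracket_add_left)

lemma bracket_square_left: "bracket (bracket x x) y = 0"
  by (simp add: leibniz)

text \<open>
  The element \<open>[x, y] + [y, x]\<close> is a combination of squares, by polarisation. This is how left and
  right multiplication by one element are compared below.
\<close>

lemma bracket_symmetrised_left: "bracket (bracket x y + bracket y x) z = 0"
  by (simp add: bracket_add_left leibniz)

lemma bracket_left_in_span:
  assumes "y \<in> span A" "\<And>z. z \<in> A \<Longrightarrow> bracket x z \<in> span B"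
  shows "bracket x y \<in> span B"
  using assms(1)
  by (induction rule: span_induct_alt)
     (auto simp: bracket_add_right bracket_scale_right intro!: span_add span_scale span_zero assms(2))


section \<open>Left powers of an element\<close>

primrec left_power :: "'v \<Rightarrow> nat \<Rightarrow> 'v"
  where
    "left_power g 0 = g"
  | "left_power g (Suc k) = bracket g (left_power g k)"

text \<open>
  The first proper power is a square. The step needs no more than the Leibniz identity, because the
  induction hypothesis is available for all right arguments.
\<close>

lemma bracket_left_power_Suc: "bracket (left_power g (Suc k)) y = 0"
proof (induction k arbitrary: y)
  case 0
  show ?case by (simp add: bracket_square_left)
next
  case (Suc k)
  have "bracket (left_power g (Suc (Suc k))) y
      = bracket g (bracket (left_power g (Suc k)) y) - bracket (left_power g (Suc k)) (bracket g y)"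
    unfolding left_power.simps(2)[of g "Suc k"] by (rule leibniz)
  then show ?case by (simp only: Suc.IH) simp
qed

definition comb :: "'v \<Rightarrow> nat \<Rightarrow> (nat \<Rightarrow> 'f) \<Rightarrow> 'v"
  where "comb g n u = (\<Sum>i<n. scale (u i) (left_power g i))"

lemma bracket_comb_left:
  assumes "n > 0"
  shows "bracket (comb g n u) y = scale (u 0) (bracket g y)"
proof -
  obtain m where n: "n = Suc m" using assms by (cases n) auto
  have "bracket (comb g n u) y = (\<Sum>i<n. scale (u i) (bracket (left_power g i) y))"
    by (simp add: comb_def bracket_sum_left bracket_scale_left)
  also have "\<dots> = scale (u 0) (bracket g y)"
    unfolding n sum.lessThan_Suc_shift by (simp add: bracket_left_power_Suc del: left_power.simps(2))
  finally show ?thesis .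
qed

lemma bracket_comb_right:
  "bracket g (comb g n u) = (\<Sum>i<n. scale (u i) (left_power g (Suc i)))"
  by (simp add: comb_def bracket_sum_right bracket_scale_right)

lemma left_power_eq_0_mono:
  assumes "left_power g n = 0" "n \<le> k"
  shows "left_power g k = 0"
  using assms(2,1) by (induction k rule: dec_induct) auto

text \<open>
  Left multiplication by \<open>g\<close> shifts the powers. Once the coefficients before the \<open>i\<close>-th are known to
  vanish, shifting \<open>m - i\<close> times pushes all later terms beyond \<open>m\<close> and leaves only the \<open>i\<close>-th, sitting
  at the last nonzero power.
\<close>

lemma comb_eq_0_imp_coeff_eq_0:
  assumes top: "left_power g (Suc m) = 0" "left_power g m \<noteq> 0"
    and "comb g (Suc m) u = 0" "i \<le> m"
  shows "u i = 0"
  using assms(4)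
proof (induction i rule: less_induct)
  case (less i)
  have shift: "(\<Sum>j<Suc m. scale (u j) (left_power g (j + q))) = 0" for q
  proof (induction q)
    case 0
    then show ?case using assms(3) by (simp add: comb_def)
  next
    case (Suc q)
    have "bracket g (\<Sum>j<Suc m. scale (u j) (left_power g (j + q))) = 0"
      unfolding Suc.IH by simp
    then show ?case
      unfolding bracket_sum_right bracket_scale_right by simp
  qed
  have "0 = (\<Sum>j<Suc m. scale (u j) (left_power g (j + (m - i))))"
    by (rule shift[symmetric])
  also have "\<dots> = (\<Sum>j<Suc m. if j = i then scale (u i) (left_power g m) else 0)"
  proof (rule sum.cong)
    fix j assume j: "j \<in> {..<Suc m}"
    consider "j < i" | "j = i" | "j > i" by linarith
    then show "scale (u j) (left_power g (j + (m - i)))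
        = (if j = i then scale (u i) (left_power g m) else 0)"
    proof cases
      case 1
      then show ?thesis using less by simp
    next
      case 2
      then show ?thesis using less.prems by simp
    next
      case 3
      then have "left_power g (j + (m - i)) = 0"
        using less.prems by (intro left_power_eq_0_mono[OF top(1)]) simp
      then show ?thesis using 3 by simp
    qed
  qed simp
  also have "\<dots> = scale (u i) (left_power g m)"
    using less.prems by simp
  finally show ?case using top(2) by simp
qed

lemma left_powers_inj:
  assumes top: "left_power g (Suc m) = 0" "left_power g m \<noteq> 0"
  shows "inj_on (left_power g) {..<Suc m}"
proof (rule inj_onI, rule ccontr)
  fix i j
  assume ij: "i \<in> {..<Suc m}" "j \<in> {..<Suc m}" "left_power g i = left_power g j" "i \<noteq> j"
  define u :: "nat \<Rightarrow> 'f" where "u k = (if k = i then 1 else 0) - (if k = j then 1 else 0)" for k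
  have "comb g (Suc m) u = (\<Sum>k<Suc m. if k = i then left_power g i else 0)
      - (\<Sum>k<Suc m. if k = j then left_power g j else 0)"
    unfolding comb_def sum_subtractf[symmetric] using ij
    by (intro sum.cong) (auto simp: u_def scale_left_diff_distrib)
  also have "\<dots> = 0"
    using ij by simp
  finally have "u i = 0"
    using comb_eq_0_imp_coeff_eq_0[OF top, of u i] ij by simp
  then show False using ij by (simp add: u_def)
qed

lemma left_powers_independent:
  assumes top: "left_power g (Suc m) = 0" "left_power g m \<noteq> 0"
  shows "independent (left_power g ` {..<Suc m})"
proof (rule independent_if_scalars_zero)
  fix f x
  assume "(\<Sum>x\<in>left_power g ` {..<Suc m}. scale (f x) x) = 0"
    and x: "x \<in> left_power g ` {..<Suc m}"
  then have "comb g (Suc m) (\<lambda>i. f (left_power g i)) = 0"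
    by (simp add: comb_def sum.reindex[OF left_powers_inj[OF top]] del: sum.lessThan_Suc)
  then show "f x = 0"
    using comb_eq_0_imp_coeff_eq_0[OF top] x by fastforce
qed simp

lemma in_span_left_powers_iff:
  "x \<in> span (left_power g ` {..<n}) \<longleftrightarrow> (\<exists>u. x = comb g n u)"
proof
  assume "x \<in> span (left_power g ` {..<n})"
  then show "\<exists>u. x = comb g n u"
  proof (induction rule: span_induct_alt)
    case base
    show ?case by (rule exI[of _ "\<lambda>_. 0"]) (simp add: comb_def)
  next
    case (step c x y)
    from step obtain u k where u: "y = comb g n u" "k < n" "x = left_power g k" by auto
    have "comb g n (\<lambda>i. u i + (if i = k then c else 0))
        = y + (\<Sum>i<n. if i = k then scale c x else 0)"
      unfolding u comb_def sum.distrib[symmetric]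
      by (intro sum.cong) (auto simp: scale_left_distrib)
    also have "\<dots> = scale c x + y" using u(2) by simp
    finally show ?case by metis
  qed
next
  assume "\<exists>u. x = comb g n u"
  then show "x \<in> span (left_power g ` {..<n})"
    unfolding comb_def by (auto intro: span_sum span_scale[OF span_base])
qed


section \<open>Nilpotent cyclic subalgebras\<close>

text \<open>
  Only the multiples of \<open>g\<close> itself act nontrivially from the left, and they shift the powers; this is
  why right-nested products already exhaust the generated subalgebra.
\<close>

lemma subalgebra_span_left_powers: "subalgebra (span (range (left_power g)))"
  unfolding subalgebra_def
proof (intro conjI ballI)
  let ?V = "span (range (left_power g))"
  show "subspace ?V" by (rule subspace_span)
  fix x y assume x: "x \<in> ?V" and y: "y \<in> ?V"
  have g: "bracket g y \<in> ?V"
    using y by (rule bracket_left_in_span) (auto simp flip: left_power.simps(2) intro!: span_base)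
  from x show "bracket x y \<in> ?V"
  proof (induction rule: span_induct_alt)
    case base
    show ?case by (simp add: span_zero)
  next
    case (step c x z)
    then obtain k where "x = left_power g k" by auto
    then have "bracket x y \<in> ?V"
      using g by (cases k) (simp_all add: bracket_left_power_Suc span_zero del: left_power.simps(2))
    then show ?case
      using step by (simp add: bracket_add_left bracket_scale_left span_add span_scale)
  qed
qed

lemma subalgebra_left_power:
  assumes "subalgebra S" "g \<in> S"
  shows "left_power g k \<in> S"
  using assms by (induction k) (auto simp: subalgebra_def)

lemma subalgebra_hull_singleton: "subalgebra hull {g} = span (range (left_power g))"
proof (rule hull_unique)
  have "left_power g 0 \<in> span (range (left_power g))" by (intro span_base rangeI)
  then show "{g} \<subseteq> span (range (left_power g))" by simp
  show "subalgebra (span (range (left_power g)))" by (rule subalgebra_span_left_powers)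
  fix T assume "{g} \<subseteq> T" "subalgebra T"
  then show "span (range (left_power g)) \<subseteq> T"
    by (intro span_minimal) (auto simp: subalgebra_left_power, simp add: subalgebra_def)
qed

lemma left_power_in_lower_central:
  assumes "g \<in> S"
  shows "left_power g k \<in> lower_central S k"
  using assms by (induction k) (auto intro: span_base)

text \<open>
  The \<open>k\<close>-th left power lies in the \<open>k\<close>-th term of the lower central series, so some power vanishes.
  The powers before the first vanishing one are a basis, which identifies that first exponent with the
  dimension.
\<close>

lemma nilpotent_cyclic_basis:
  assumes "cyclic K" "nilpotent K" "dim K = n" "n > 0"
  obtains g where "left_power g n = 0" "\<And>k. k < n \<Longrightarrow> left_power g k \<noteq> 0"
    "K = span (left_power g ` {..<n})"
proof -
  from assms(1) obtain g where g: "g \<in> K" "K = subalgebra hull {g}"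
    by (auto simp: cyclic_def)
  then have K: "K = span (range (left_power g))" by (simp add: subalgebra_hull_singleton)
  from assms(2) obtain c where "lower_central K c = {0}" by (auto simp: nilpotent_def)
  then have ex: "left_power g c = 0" using left_power_in_lower_central[OF g(1), of c] by simp
  define N where "N = (LEAST k. left_power g k = 0)"
  have zero: "left_power g N = 0" unfolding N_def by (rule LeastI[of _ c]) (rule ex)
  have nonzero: "left_power g k \<noteq> 0" if "k < N" for k
    using not_less_Least that unfolding N_def by blast
  have "range (left_power g) \<subseteq> span (left_power g ` {..<N})"
  proof
    fix x assume "x \<in> range (left_power g)"
    then obtain k where "x = left_power g k" by auto
    then show "x \<in> span (left_power g ` {..<N})"
      using left_power_eq_0_mono[OF zero, of k]
      by (cases "k < N") (auto intro: span_base span_zero)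
  qed
  then have K': "K = span (left_power g ` {..<N})"
    unfolding K by (intro span_eq[THEN iffD2] conjI) (auto intro: span_base)
  have "N \<noteq> 0"
  proof
    assume "N = 0"
    then have "dim K = 0" using dim_span[of "{}"] dim_eq_card_independent[OF independent_empty] K' by simp
    then show False using assms(3,4) by simp
  qed
  then obtain m where m: "N = Suc m" by (cases N) auto
  have top: "left_power g (Suc m) = 0" "left_power g m \<noteq> 0" using zero nonzero m by auto
  have "dim K = N"
    unfolding K' dim_span m dim_eq_card_independent[OF left_powers_independent[OF top]]
    by (simp add: card_image[OF left_powers_inj[OF top]])
  then have "N = n" using assms(3) by simp
  then show thesis using that zero nonzero K' by blast
qed


section \<open>Ideals of codimension one\<close>

lemma codim_one_decomposition:
  assumes "subspace K" "dim (UNIV :: 'v set) = dim K + 1" "dim K > 0" "d \<notin> K"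
  shows "\<exists>y\<in>K. \<exists>t. x = y + scale t d"
proof -
  obtain B where B: "B \<subseteq> K" "independent B" "K \<subseteq> span B" "card B = dim K"
    using basis_exists by blast
  have KB: "span B = K" using B assms(1) by (metis span_minimal subset_antisym)
  have finB: "finite B" using B(4) assms(3) card_gt_0_iff by metis
  obtain C where C: "independent C" "UNIV \<subseteq> span C" "card C = dim (UNIV :: 'v set)"
    using basis_exists[of UNIV] by blast
  have finC: "finite C" using C(3) assms(2) by (metis add_is_0 card.infinite one_neq_zero)
  have indep: "independent (insert d B)"
    using B(2) KB assms(4) by (simp add: independent_insertI)
  have "x \<in> span (insert d B)"
  proof (rule ccontr)
    assume x: "x \<notin> span (insert d B)"
    then have "independent (insert x (insert d B))" using indep by (rule independent_insertI)
    then have "card (insert x (insert d B)) \<le> card C"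
      using independent_span_bound[OF finC] C(2) by blast
    moreover have "x \<notin> insert d B" "d \<notin> B"
      using x span_base assms(4) KB by auto
    ultimately show False using finB B(4) C(3) assms(2) by simp
  qed
  then obtain t where "x - scale t d \<in> span B" by (auto simp: span_insert)
  then show ?thesis using KB by (metis diff_add_cancel)
qed

text \<open>
  The only bracket not covered by the ideal property is \<open>[d, d]\<close>. If \<open>[d, d] = k + t d\<close> with \<open>k \<in> K\<close>,
  then \<open>0 = [[d, d], d] = [k, d] + t [d, d]\<close>, so \<open>[d, d]\<close> is in \<open>K\<close> whether or not \<open>t\<close> is zero.
\<close>

lemma codim_one_ideal_bracket:
  assumes K: "ideal K" and dec: "\<And>x. \<exists>y\<in>K. \<exists>t. x = y + scale t d"
  shows "bracket x y \<in> K"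
proof -
  have sub: "subspace K" and abs: "\<And>x y. x \<in> K \<Longrightarrow> bracket x y \<in> K" "\<And>x y. x \<in> K \<Longrightarrow> bracket y x \<in> K"
    using K by (auto simp: ideal_def)
  obtain k t where kt: "k \<in> K" "bracket d d = k + scale t d" using dec by blast
  have dd: "bracket d d \<in> K"
  proof (cases "t = 0")
    case True
    then show ?thesis using kt by simp
  next
    case False
    have "bracket k d + scale t (bracket d d) = 0"
    proof -
      have "bracket (bracket d d) d = bracket (k + scale t d) d" by (simp only: kt(2))
      then show ?thesis
        by (simp only: bracket_square_left bracket_add_left bracket_scale_left)
    qed
    then have "scale t (bracket d d) = - bracket k d"
      by (simp add: eq_neg_iff_add_eq_0 add.commute)
    then have "scale t (bracket d d) \<in> K"
      using abs(1)[OF kt(1)] subspace_neg[OF sub] by simp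
    then have "scale (inverse t) (scale t (bracket d d)) \<in> K" by (rule subspace_scale[OF sub])
    then show ?thesis using False by simp
  qed
  obtain k t where x: "k \<in> K" "x = k + scale t d" using dec by blast
  obtain l s where y: "l \<in> K" "y = l + scale s d" using dec by blast
  have "bracket x y = bracket k y + (scale t (bracket d l) + scale t (scale s (bracket d d)))"
    unfolding x(2) by (simp add: y(2) bracket_add_left bracket_scale_left bracket_add_right
        bracket_scale_right scale_right_distrib)
  also have "\<dots> \<in> K"
    using abs x(1) y(1) dd by (intro subspace_add[OF sub] subspace_scale[OF sub]) auto
  finally show ?thesis .
qed


section \<open>The action of an outer element\<close>

text \<open>
  The Leibniz identity says that left multiplication by \<open>d\<close> is a derivation. Applied to
  \<open>[g, p\<^sub>k]\<close> it contributes one more \<open>c\<^sub>0\<close> at each step, as \<open>[d, g]\<close> acts on \<open>p\<^sub>k\<close> from the left like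
  \<open>c\<^sub>0 g\<close>. The sum over all \<open>i < n\<close> still contains the leading term \<open>c\<^sub>0 p\<^sub>k\<close>, hence the factor \<open>k\<close>
  instead of \<open>k + 1\<close> in front.
\<close>

lemma bracket_left_power_right:
  assumes n: "n > 0" and d: "bracket d g = comb g n c"
  shows "bracket d (left_power g k)
    = scale (of_nat k * c 0) (left_power g k) + (\<Sum>i<n. scale (c i) (left_power g (i + k)))"
proof (induction k)
  case 0
  then show ?case by (simp add: d comb_def)
next
  case (Suc k)
  have "bracket d (left_power g (Suc k))
      = bracket (bracket d g) (left_power g k) + bracket g (bracket d (left_power g k))"
    by (simp add: leibniz)
  also have "bracket (bracket d g) (left_power g k) = scale (c 0) (left_power g (Suc k))"
    unfolding d bracket_comb_left[OF n] by simp
  also have "bracket g (bracket d (left_power g k))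
      = scale (of_nat k * c 0) (left_power g (Suc k))
        + (\<Sum>i<n. scale (c i) (left_power g (i + Suc k)))"
    unfolding Suc.IH by (simp add: bracket_add_right bracket_scale_right bracket_sum_right)
  finally show ?case
    by (simp add: scale_left_distrib distrib_right add.assoc)
qed

text \<open>
  With \<open>c\<^sub>0 = 0\<close> every left multiplication sends the span of \<open>p\<^sub>k, p\<^sub>k\<^sub>+\<^sub>1, \<dots>\<close> into that of
  \<open>p\<^sub>k\<^sub>+\<^sub>1, p\<^sub>k\<^sub>+\<^sub>2, \<dots>\<close>. From its second term on, the lower central series lies in these spans, the
  first of which is \<open>K\<close>.
\<close>

lemma nilpotent_if_weight_zero:
  assumes n: "n > 0" and top: "left_power g n = 0"
    and K: "K = span (left_power g ` {..<n})"
    and dec: "\<And>x. \<exists>y\<in>K. \<exists>t. x = y + scale t d"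
    and brK: "\<And>x y. bracket x y \<in> K"
    and d: "bracket d g = comb g n c" and c0: "c 0 = 0"
  shows "nilpotent UNIV"
proof -
  let ?V = "\<lambda>k. span (left_power g ` {k..})"
  have step: "bracket x (left_power g j) \<in> ?V (Suc k)" if "k \<le> j" for x j k
  proof -
    obtain y t where y: "y \<in> K" "x = y + scale t d" using dec by blast
    obtain u where u: "y = comb g n u" using y K in_span_left_powers_iff by blast
    have "left_power g (Suc j) \<in> ?V (Suc k)" using that by (intro span_base imageI) simp
    then have "bracket y (left_power g j) \<in> ?V (Suc k)"
      unfolding u bracket_comb_left[OF n] by (simp add: span_scale)
    moreover have "scale (c i) (left_power g (i + j)) \<in> ?V (Suc k)" for i
    proof (cases i)
      case 0
      then show ?thesis using c0 by (simp add: span_zero)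
    next
      case (Suc l)
      then have "i + j \<in> {Suc k..}" using that by simp
      then show ?thesis by (intro span_scale span_base imageI)
    qed
    then have "bracket d (left_power g j) \<in> ?V (Suc k)"
      unfolding bracket_left_power_right[OF n d] using c0 by (auto intro!: span_sum)
    ultimately show ?thesis
      unfolding y(2) by (simp add: bracket_add_left bracket_scale_left span_add span_scale)
  qed
  have incl: "lower_central UNIV (Suc k) \<subseteq> ?V k" for k
  proof (induction k)
    case 0
    have "K \<subseteq> ?V 0" unfolding K by (intro span_mono) auto
    have "lower_central UNIV (Suc 0) \<subseteq> ?V 0"
      unfolding lower_central.simps using brK \<open>K \<subseteq> ?V 0\<close>
      by (intro span_minimal subspace_span) auto
    then show ?case .
  next
    case (Suc k)
    have "bracket x y \<in> ?V (Suc k)" if "y \<in> lower_central UNIV (Suc k)" for x y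
      using Suc.IH that step by (intro bracket_left_in_span[of y "left_power g ` {k..}"]) auto
    then show ?case
      unfolding lower_central.simps(2)[of UNIV "Suc k"] by (intro span_minimal) auto
  qed
  have "left_power g ` {n..} \<subseteq> {0}" using left_power_eq_0_mono[OF top] by auto
  then have "?V n \<subseteq> {0}" using span_minimal[of _ "{0}"] by (simp add: subspace_0)
  then have "lower_central UNIV (Suc n) = {0}"
    using incl[of n] span_zero by fastforce
  then show ?thesis unfolding nilpotent_def by blast
qed

text \<open>
  The sum \<open>[g, d] + [d, g]\<close> annihilates \<open>g\<close> from the left, whereas an element of \<open>K\<close> does so only if
  its coefficient at \<open>g\<close> vanishes.
\<close>

lemma weights_opposite:
  assumes "n > 0" "left_power g 1 \<noteq> 0"
    and "bracket d g = comb g n c" "bracket g d = comb g n b"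
  shows "b 0 = - c 0"
proof -
  have "scale (b 0 + c 0) (left_power g 1) = bracket (bracket g d + bracket d g) g"
    using assms by (simp add: bracket_add_left bracket_comb_left scale_left_distrib)
  also have "\<dots> = 0" by (rule bracket_symmetrised_left)
  finally show ?thesis using assms(2) by (simp add: eq_neg_iff_add_eq_0)
qed

text \<open>
  After scaling, \<open>[g, d] = -g + \<Sum> b\<^sub>i p\<^sub>i\<close> with \<open>i \<ge> 1\<close>, and the sum equals \<open>[g, x]\<close> for \<open>x = \<Sum> b\<^sub>i p\<^sub>i\<^sub>-\<^sub>1\<close>.
  So \<open>d - x\<close> is the required element.
\<close>

lemma exists_normalised_outer_element:
  assumes n: "n \<ge> 2" and p1: "left_power g 1 \<noteq> 0"
    and K: "K = span (left_power g ` {..<n})"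
    and d: "d \<notin> K" "bracket d g = comb g n c" "c 0 \<noteq> 0" and gd: "bracket g d \<in> K"
  obtains d' where "d' \<notin> K" "bracket g d' = - g"
proof -
  obtain b where b: "bracket g d = comb g n b" using gd K in_span_left_powers_iff by blast
  obtain m where m: "n = Suc m" using n by (cases n) auto
  define s where "s = inverse (c 0)"
  have sb: "s * b 0 = - 1" using weights_opposite[OF _ p1 d(2) b] n d(3) by (simp add: s_def)
  define x where "x = comb g m (\<lambda>i. s * b (Suc i))"
  have "bracket g (scale s d) = comb g (Suc m) (\<lambda>i. s * b i)"
    by (simp add: bracket_scale_right b comb_def scale_sum_right m del: sum.lessThan_Suc)
  also have "\<dots> = - g + bracket g x"
    unfolding bracket_comb_right x_def unfolding comb_def sum.lessThan_Suc_shift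
    by (simp add: sb del: sum.lessThan_Suc)
  finally have gd': "bracket g (scale s d - x) = - g" by (simp add: bracket_diff_right)
  have x: "x \<in> K"
    unfolding x_def K comb_def m by (intro span_sum span_scale span_base imageI) auto
  have "scale s d - x \<notin> K"
  proof
    assume "scale s d - x \<in> K"
    then have "scale s d \<in> K" using span_add x K by (metis diff_add_cancel)
    then have "scale (c 0) (scale s d) \<in> K" using K span_scale by blast
    then show False using d(1,3) by (simp add: s_def)
  qed
  then show thesis using that gd' by blast
qed

text \<open>
  Since \<open>[d, g]\<close> acts from the left like \<open>c\<^sub>0 g = g\<close>, the Leibniz identity for \<open>[[d, g], d]\<close> becomes
  \<open>-g = -[d, g] - [g, [d, d]]\<close>. Bracketing with \<open>g\<close> shifts \<open>[d, d]\<close> by one, so its coefficients are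
  those of \<open>-[d, g]\<close> one place up; only the last one is lost, as \<open>[g, p\<^sub>m] = 0\<close>. The coefficient at \<open>g\<close>
  vanishes separately because \<open>[d, d]\<close> is a square, so that also \<open>c\<^sub>1 = 0\<close>.
\<close>

lemma square_of_normalised_outer_element:
  assumes n: "n = Suc m" "m \<ge> 1" and top: "left_power g n = 0" "left_power g 1 \<noteq> 0" "left_power g m \<noteq> 0"
    and d: "bracket d g = comb g n c" "bracket g d = - g" "bracket d d = comb g n e"
  shows "c 0 = 1" "e 0 = 0" "\<And>i. i < m \<Longrightarrow> e i = - c (Suc i)"
proof -
  have n0: "n > 0" using n by simp
  have "scale (c 0 - 1) (left_power g 1) = bracket (bracket g d + bracket d g) g"
    by (simp add: d bracket_add_left bracket_comb_left[OF n0] bracket_minus_left bracket_diff_left scale_left_diff_distrib)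
  also have "\<dots> = 0" by (rule bracket_symmetrised_left)
  finally show c0: "c 0 = 1" using top(2) by simp
  have "scale (e 0) (left_power g 1) = bracket (bracket d d) g"
    by (simp add: d bracket_comb_left[OF n0])
  also have "\<dots> = 0" by (rule bracket_square_left)
  finally show "e 0 = 0" using top(2) by simp
  have "bracket (bracket d g) d = bracket d (bracket g d) - bracket g (bracket d d)"
    by (rule leibniz)
  then have "bracket g (comb g n e) + comb g n c - g = 0"
    by (simp add: d bracket_comb_left[OF n0] c0 bracket_minus_right algebra_simps)
  moreover have "bracket g (comb g n e) = (\<Sum>i<m. scale (e i) (left_power g (Suc i)))"
    using top(1) unfolding bracket_comb_right n(1) by simp
  moreover have "comb g n c = g + (\<Sum>i<m. scale (c (Suc i)) (left_power g (Suc i)))"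
    unfolding comb_def n(1) sum.lessThan_Suc_shift by (simp add: c0)
  ultimately have "(\<Sum>i<m. scale (e i + c (Suc i)) (left_power g (Suc i))) = 0"
    by (simp add: scale_left_distrib sum.distrib)
  \<comment> \<open>Prepending a zero coefficient turns this into a relation among all powers up to the \<open>m\<close>-th.\<close>
  then have "comb g (Suc m) (\<lambda>i. case i of 0 \<Rightarrow> 0 | Suc j \<Rightarrow> e j + c (Suc j)) = 0"
    unfolding comb_def sum.lessThan_Suc_shift by simp
  note coeffs = comb_eq_0_imp_coeff_eq_0[OF top(1)[unfolded n(1)] top(3) this]
  show "e i = - c (Suc i)" if "i < m" for i
    using coeffs[of "Suc i"] that by (simp add: eq_neg_iff_add_eq_0)
qed

end

theorem theorem2:
  fixes scale :: "'f::field \<Rightarrow> 'v::ab_group_add \<Rightarrow> 'v" (infixr "*\<^sub>F" 75)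
    and bracket :: "'v \<Rightarrow> 'v \<Rightarrow> 'v" ("\<lbrace>_, _\<rbrace>")
    and K :: "'v set"
    and n :: nat
  assumes "leibniz_algebra scale bracket"
    and "\<not> leibniz_algebra.nilpotent scale bracket UNIV"
    and "vector_space.dim scale (UNIV :: 'v set) = n + 1"
    and "n + 1 \<ge> 3"
    and "leibniz_algebra.ideal scale bracket K"
    and "vector_space.dim scale (UNIV :: 'v set) = vector_space.dim scale K + 1"
    and "leibniz_algebra.cyclic scale bracket K"
    and "leibniz_algebra.nilpotent scale bracket K"
  shows "\<exists>(d :: 'v) (a :: nat \<Rightarrow> 'v) (\<gamma> :: nat \<Rightarrow> 'f) (\<delta> :: 'f).
      inj_on a {1..n} \<and> \<not> module.dependent scale (a ` {1..n}) \<and> module.span scale (a ` {1..n}) = K \<and>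
      d \<noteq> 0 \<and> K \<inter> module.span scale {d} = {0} \<and>
      {x + y | x y. x \<in> K \<and> y \<in> module.span scale {d}} = UNIV \<and>
      \<lbrace>a 1, a 1\<rbrace> = a 2 \<and>
      (\<forall>j\<in>{3..n}. \<lbrace>a 1, a (j - 1)\<rbrace> = a j) \<and>
      \<lbrace>a 1, a n\<rbrace> = 0 \<and>
      (\<forall>m\<in>{1<..n}. \<forall>k\<in>{1..n}. \<lbrace>a m, a k\<rbrace> = 0) \<and>
      \<lbrace>a 1, d\<rbrace> = - a 1 \<and>
      (\<forall>j\<in>{2..n}. \<lbrace>a j, d\<rbrace> = 0) \<and>
      (\<forall>k\<in>{1..n}. \<lbrace>d, a k\<rbrace> = of_nat k *\<^sub>F a k + (\<Sum>j = 2..n - k + 1. \<gamma> j *\<^sub>F a (j + k - 1))) \<and>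
      \<lbrace>d, d\<rbrace> = - (\<Sum>j = 3..n. \<gamma> j *\<^sub>F a (j - 1)) + \<delta> *\<^sub>F a n"
proof -
  interpret leibniz_algebra scale bracket by (rule assms(1))
  have sub: "subspace K" using assms(5) by (simp add: ideal_def)
  have n: "n \<ge> 2" and n0: "n > 0" and dimK: "dim K = n" using assms(3,4,6) by auto
  obtain g where top: "left_power g n = 0" "\<And>k. k < n \<Longrightarrow> left_power g k \<noteq> 0"
    and K: "K = span (left_power g ` {..<n})"
    using nilpotent_cyclic_basis[OF assms(7,8) dimK n0] by blast
  have p1: "left_power g 1 \<noteq> 0" using top(2)[of 1] n by simp
  have dec: "\<exists>y\<in>K. \<exists>t. x = y + scale t d" if "d \<notin> K" for d x
    using codim_one_decomposition[OF sub assms(6) _ that] dimK n0 by simp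
  have "K \<noteq> UNIV" using assms(6) by auto
  then obtain d0 where d0: "d0 \<notin> K" by blast
  have brK: "bracket x y \<in> K" for x y
    using codim_one_ideal_bracket[OF assms(5) dec[OF d0]] .
  have coeffs: "\<exists>u. bracket x y = comb g n u" for x y
    using brK[of x y] K in_span_left_powers_iff by blast
  obtain c0 where c0: "bracket d0 g = comb g n c0" using coeffs by blast
  have "c0 0 \<noteq> 0"
    using nilpotent_if_weight_zero[OF n0 top(1) K dec[OF d0] brK c0] assms(2) by blast
  then obtain d where d: "d \<notin> K" "bracket g d = - g"
    using exists_normalised_outer_element[OF n p1 K d0 c0 _ brK] by blast
  obtain c e where c: "bracket d g = comb g n c" and e: "bracket d d = comb g n e"
    using coeffs by metis
  define m where "m = n - 1"
  have m: "n = Suc m" "m \<ge> 1" using n by (auto simp: m_def)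
  have pm: "left_power g m \<noteq> 0" using top(2) m by simp
  note sq = square_of_normalised_outer_element[OF m top(1) p1 pm c d(2) e]
  define a where "a k = left_power g (k - 1)" for k
  define \<gamma> where "\<gamma> j = c (j - 1)" for j
  have "(\<lambda>k. k - 1) ` {1..n} = {..<n}"
    by (auto simp: image_iff intro!: bexI[of _ "Suc _"])
  then have img: "a ` {1..n} = left_power g ` {..<n}"
    unfolding a_def image_image[of "left_power g" "\<lambda>k. k - 1", symmetric] by simp
  have inj_p: "inj_on (left_power g) {..<n}"
    using left_powers_inj top(1) pm m by auto
  have indep: "independent (a ` {1..n})"
    unfolding img using left_powers_independent top(1) pm m by auto
  have inj: "inj_on a {1..n}"
  proof (rule inj_onI)
    fix x y assume xy: "x \<in> {1..n}" "y \<in> {1..n}" "a x = a y"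
    then have "x - 1 = y - 1"
      unfolding a_def by (intro inj_onD[OF inj_p]) auto
    then show "x = y" using xy(1,2) by auto
  qed
  have spanK: "span (a ` {1..n}) = K" unfolding img K ..
  have cap: "K \<inter> span {d} = {0}"
  proof -
    have "scale t d = 0" if "scale t d \<in> K" for t
    proof (rule ccontr)
      assume "scale t d \<noteq> 0"
      then have "t \<noteq> 0" by auto
      then have "d = scale (inverse t) (scale t d)" by simp
      then show False using d(1) subspace_scale[OF sub that] by metis
    qed
    then show ?thesis using subspace_0[OF sub] span_zero by (auto simp: span_singleton)
  qed
  have total: "{x + y | x y. x \<in> K \<and> y \<in> span {d}} = UNIV"
    using dec[OF d(1)] by (fastforce simp: span_singleton)
  have left: "bracket (a j) y = 0" if "j \<in> {2..n}" for j y
  proof -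
    have "j - 1 = Suc (j - 2)" using that by auto
    then show ?thesis unfolding a_def by (simp only: bracket_left_power_Suc)
  qed
  have right: "bracket d (a k) = scale (of_nat k) (a k) + (\<Sum>j = 2..n - k + 1. scale (\<gamma> j) (a (j + k - 1)))"
    if k: "k \<in> {1..n}" for k
  proof -
    obtain l where l: "k = Suc l" "l < n" using k by (cases k) auto
    have "(\<Sum>i<n. scale (c i) (left_power g (i + l)))
        = left_power g l + (\<Sum>i<m. scale (c (Suc i)) (left_power g (Suc i + l)))"
      unfolding m(1) sum.lessThan_Suc_shift by (simp add: sq(1))
    also have "(\<Sum>i<m. scale (c (Suc i)) (left_power g (Suc i + l)))
        = (\<Sum>i<m - l. scale (c (Suc i)) (left_power g (Suc i + l)))"
      by (rule sum.mono_neutral_right)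
         (auto simp: m(1) simp del: left_power.simps(2) intro!: left_power_eq_0_mono[OF top(1)])
    also have "\<dots> = (\<Sum>j = 2..n - k + 1. scale (\<gamma> j) (a (j + k - 1)))"
      by (rule sum.reindex_bij_witness[of _ "\<lambda>j. j - 2" "\<lambda>i. i + 2"])
         (auto simp: a_def \<gamma>_def l m(1))
    finally show ?thesis
      using bracket_left_power_right[OF n0 c, of l]
      by (simp add: a_def l(1) sq(1) scale_left_distrib algebra_simps)
  qed
  have "bracket d d = (\<Sum>i<m. scale (e i) (left_power g i)) + scale (e m) (a n)"
    unfolding e comb_def m(1) by (simp add: a_def)
  also obtain q where q: "m = Suc q" using m(2) by (cases m) auto
  have "(\<Sum>i<m. scale (e i) (left_power g i))
      = (\<Sum>i<q. - scale (c (Suc (Suc i))) (left_power g (Suc i)))"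
    unfolding q sum.lessThan_Suc_shift using sq(2,3) q by simp
  also have "\<dots> = - (\<Sum>j = 3..n. scale (\<gamma> j) (a (j - 1)))"
    unfolding sum_negf
    by (intro arg_cong[of _ _ uminus] sum.reindex_bij_witness[of _ "\<lambda>j. j - 3" "\<lambda>i. i + 3"])
       (auto simp: a_def \<gamma>_def m(1) q)
  finally have dd: "bracket d d = - (\<Sum>j = 3..n. scale (\<gamma> j) (a (j - 1))) + scale (e m) (a n)" .
  have chain: "\<forall>j\<in>{3..n}. bracket (a 1) (a (j - 1)) = a j"
  proof
    fix j assume "j \<in> {3..n}"
    then have "j - 1 = Suc (j - 1 - 1)" by auto
    then show "bracket (a 1) (a (j - 1)) = a j"
      unfolding a_def by (metis diff_self_eq_0 left_power.simps)
  qed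
  show ?thesis
  proof (intro exI conjI ballI)
    show "bracket (a 1) (a n) = 0" using top(1) by (simp add: a_def m(1))
    show "d \<noteq> 0" using d(1) subspace_0[OF sub] by auto
    show "bracket (a 1) d = - a 1" using d(2) by (simp add: a_def)
    show "bracket (a 1) (a 1) = a 2" by (simp add: a_def)
  qed (use inj indep spanK cap total chain left right dd in auto)
qed

end
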